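(* Let $N\ge 2$ and let $V$ be an $N$-dimensional vector space, either complex with a non-degenerate symmetric bilinear form $\eta_{ab}$, or real with a Lorentz-signature inner product $\eta_{ab}$. Let $C_{abcd}$ be a Weyl-like tensor on $V$ and let $k^a\neq 0$ be a null vector in $V$ ($k^ak_a=0$). Then $k^a$ satisfies the PND equation $$k^b\, k_{[e}\, C_{a]bc[d}\, k_{f]}\, k^c=0$$ if and only if $k^a$ is aligned with $C_{abcd}$.
   Context: Indices are raised and lowered with $\eta_{ab}$; square brackets denote antisymmetrization (over the pair $e,a$ and over the pair $d,f$). Lorentz signature means exactly one time-like direction: $u^au_a<0$ for time-like and $u^au_a>0$ for space-like vectors, signature $(N-1,1)$. A Weyl-like tensor is a rank 4 covariant tensor $C_{abcd}$ on $V$ satisfying $C_{abcd}=-C_{bacd}=C_{cdab}$, $C_{abcd}+C_{acdb}+C_{adbc}=0$, and the trace condition $C_{abc}{}^{b}=0$. A null frame is a basis $\ell=m_0$, $n=m_1$, $m_2,\dots,m_{N-1}$ of $V$ with $\eta(\ell,n)=1$, $\eta(m_i,m_i)=1$ for $i=2,\dots,N-1$, and all other products zero. Components with respect to a null frame are $C_{ABCD}=C(m_A,m_B,m_C,m_D)$. The boost weight of $C_{ABCD}$ is the number of its indices equal to $0$ minus the number equal to $1$; for Weyl-like tensors the maximal boost weight is $2$, the corresponding components being $C_{0i0j}$, $2\le i,j\le N-1$. A non-zero null vector $k$ is aligned with $C$ if the components of maximal boost weight vanish, i.e. $C_{0i0j}=0$ for all $2\le i,j\le N-1$, in a null frame with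 $\ell$ a scalar multiple of $k$ (this condition does not depend on the choice of such a frame). *)

theory Defs
  imports Complex_Main
begin

text \<open>
  The scalar multiplication \<open>s\<close> of the vector space is an explicit argument, so that the same
  notions serve complex and real vector spaces. A covariant tensor of rank r is an r-linear form;
  its abstract index slots are the arguments, in order.
\<close>

definition bilinear_form ::
  "('a::field_char_0 \<Rightarrow> 'v::ab_group_add \<Rightarrow> 'v) \<Rightarrow> ('v \<Rightarrow> 'v \<Rightarrow> 'a) \<Rightarrow> bool" where
  "bilinear_form s \<eta> \<longleftrightarrow>
     (\<forall>x. Vector_Spaces.linear s (*) (\<eta> x)) \<and>
     (\<forall>y. Vector_Spaces.linear s (*) (\<lambda>x. \<eta> x y))"

definition symmetric_form :: "('v \<Rightarrow> 'v \<Rightarrow> 'a) \<Rightarrow> bool" where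
  "symmetric_form \<eta> \<longleftrightarrow> (\<forall>x y. \<eta> x y = \<eta> y x)"

definition nondegenerate_form :: "('v::zero \<Rightarrow> 'v \<Rightarrow> 'a::zero) \<Rightarrow> bool" where
  "nondegenerate_form \<eta> \<longleftrightarrow> (\<forall>x. (\<forall>y. \<eta> x y = 0) \<longrightarrow> x = 0)"

definition rank4_tensor ::
  "('a::field_char_0 \<Rightarrow> 'v::ab_group_add \<Rightarrow> 'v) \<Rightarrow> ('v \<Rightarrow> 'v \<Rightarrow> 'v \<Rightarrow> 'v \<Rightarrow> 'a) \<Rightarrow> bool" where
  "rank4_tensor s C \<longleftrightarrow>
     (\<forall>y z w. Vector_Spaces.linear s (*) (\<lambda>x. C x y z w)) \<and>
     (\<forall>x z w. Vector_Spaces.linear s (*) (\<lambda>y. C x y z w)) \<and>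
     (\<forall>x y w. Vector_Spaces.linear s (*) (\<lambda>z. C x y z w)) \<and>
     (\<forall>x y z. Vector_Spaces.linear s (*) (\<lambda>w. C x y z w))"

text \<open>Only the values \<open>e i\<close> with \<open>i < N\<close> matter for a basis \<open>e\<close>.\<close>

definition indexed_basis ::
  "('a::field_char_0 \<Rightarrow> 'v::ab_group_add \<Rightarrow> 'v) \<Rightarrow> nat \<Rightarrow> (nat \<Rightarrow> 'v) \<Rightarrow> bool" where
  "indexed_basis s N e \<longleftrightarrow>
     inj_on e {..<N} \<and>
     \<not> module.dependent s (e ` {..<N}) \<and>
     module.span s (e ` {..<N}) = UNIV"

definition lorentz_signature ::
  "(real \<Rightarrow> 'v::ab_group_add \<Rightarrow> 'v) \<Rightarrow> nat \<Rightarrow> ('v \<Rightarrow> 'v \<Rightarrow> real) \<Rightarrow> bool" where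
  "lorentz_signature s N \<eta> \<longleftrightarrow>
     (\<exists>e. indexed_basis s N e \<and>
          (\<forall>i<N. \<forall>j<N. \<eta> (e i) (e j) = (if i = j then (if i = 0 then - 1 else 1) else 0)))"

text \<open>\<open>g\<close> is the matrix of components \<open>\<eta>\<^sup>i\<^sup>j\<close> of the inverse metric in the basis \<open>e\<close>.\<close>

definition inverse_metric ::
  "nat \<Rightarrow> ('v \<Rightarrow> 'v \<Rightarrow> 'a::field_char_0) \<Rightarrow> (nat \<Rightarrow> 'v) \<Rightarrow> (nat \<Rightarrow> nat \<Rightarrow> 'a) \<Rightarrow> bool" where
  "inverse_metric N \<eta> e g \<longleftrightarrow>
     (\<forall>i<N. \<forall>k<N. (\<Sum>j<N. g i j * \<eta> (e j) (e k)) = (if i = k then 1 else 0))"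

text \<open>
  The trace contracts the second and the fourth slot with the inverse metric. It does not depend on
  the basis, and for nondegenerate \<open>\<eta>\<close> every basis has exactly one inverse metric (on indices
  below \<open>N\<close>), so the universal quantification is over equivalent conditions.
\<close>

definition trace_free ::
  "('a::field_char_0 \<Rightarrow> 'v::ab_group_add \<Rightarrow> 'v) \<Rightarrow> nat \<Rightarrow> ('v \<Rightarrow> 'v \<Rightarrow> 'a) \<Rightarrow>
   ('v \<Rightarrow> 'v \<Rightarrow> 'v \<Rightarrow> 'v \<Rightarrow> 'a) \<Rightarrow> bool" where
  "trace_free s N \<eta> C \<longleftrightarrow>
     (\<forall>e g. indexed_basis s N e \<longrightarrow> inverse_metric N \<eta> e g \<longrightarrow>
        (\<forall>x y. (\<Sum>i<N. \<Sum>j<N. g i j * C x (e i) y (e j)) = 0))"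

definition weyl_like ::
  "('a::field_char_0 \<Rightarrow> 'v::ab_group_add \<Rightarrow> 'v) \<Rightarrow> nat \<Rightarrow> ('v \<Rightarrow> 'v \<Rightarrow> 'a) \<Rightarrow>
   ('v \<Rightarrow> 'v \<Rightarrow> 'v \<Rightarrow> 'v \<Rightarrow> 'a) \<Rightarrow> bool" where
  "weyl_like s N \<eta> C \<longleftrightarrow>
     rank4_tensor s C \<and>
     (\<forall>a b c d. C a b c d = - C b a c d) \<and>
     (\<forall>a b c d. C a b c d = C c d a b) \<and>
     (\<forall>a b c d. C a b c d + C a c d b + C a d b c = 0) \<and>
     trace_free s N \<eta> C"

text \<open>\<open>m 0\<close> is \<open>\<ell>\<close> and \<open>m 1\<close> is \<open>n\<close>.\<close>

definition null_frame ::
  "('a::field_char_0 \<Rightarrow> 'v::ab_group_add \<Rightarrow> 'v) \<Rightarrow> nat \<Rightarrow> ('v \<Rightarrow> 'v \<Rightarrow> 'a) \<Rightarrow>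
   (nat \<Rightarrow> 'v) \<Rightarrow> bool" where
  "null_frame s N \<eta> m \<longleftrightarrow>
     indexed_basis s N m \<and>
     (\<forall>i<N. \<forall>j<N. \<eta> (m i) (m j) =
        (if (i, j) = (0, 1) \<or> (i, j) = (1, 0) \<or> (i = j \<and> 2 \<le> i) then 1 else 0))"

text \<open>
  The components \<open>C\<^sub>0\<^sub>i\<^sub>0\<^sub>j\<close> are those of boost weight 2. The condition is the same in all null
  frames whose first vector is a multiple of \<open>k\<close>.
\<close>

definition aligned ::
  "('a::field_char_0 \<Rightarrow> 'v::ab_group_add \<Rightarrow> 'v) \<Rightarrow> nat \<Rightarrow> ('v \<Rightarrow> 'v \<Rightarrow> 'a) \<Rightarrow>
   ('v \<Rightarrow> 'v \<Rightarrow> 'v \<Rightarrow> 'v \<Rightarrow> 'a) \<Rightarrow> 'v \<Rightarrow> bool" where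
  "aligned s N \<eta> C k \<longleftrightarrow>
     k \<noteq> 0 \<and> \<eta> k k = 0 \<and>
     (\<exists>m. null_frame s N \<eta> m \<and> (\<exists>c. m 0 = s c k) \<and>
          (\<forall>i\<in>{2..N - 1}. \<forall>j\<in>{2..N - 1}. C (m 0) (m i) (m 0) (m j) = 0))"

definition antisymmetrize :: "('v \<Rightarrow> 'v \<Rightarrow> 'a::field_char_0) \<Rightarrow> 'v \<Rightarrow> 'v \<Rightarrow> 'a" where
  "antisymmetrize T x y = (T x y - T y x) / 2"

text \<open>The lowered vector \<open>k\<^sub>e\<close> is the form \<open>\<eta> k\<close>; contraction with \<open>k\<^sup>b\<close>, \<open>k\<^sup>c\<close> is evaluation at \<open>k\<close>.\<close>

definition PND_equation ::
  "('v \<Rightarrow> 'v \<Rightarrow> 'a::field_char_0) \<Rightarrow> ('v \<Rightarrow> 'v \<Rightarrow> 'v \<Rightarrow> 'v \<Rightarrow> 'a) \<Rightarrow> 'v \<Rightarrow> bool" where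
  "PND_equation \<eta> C k \<longleftrightarrow>
     (\<forall>e a d f.
        antisymmetrize (\<lambda>e a. antisymmetrize (\<lambda>d f. \<eta> k e * C a k k d * \<eta> k f) d f) e a = 0)"

end

theory Submission
  imports Defs
begin

text \<open>
  Both conditions say that the symmetric form \<open>C k x k y\<close> vanishes for \<open>x\<close>, \<open>y\<close> in the hyperplane
  orthogonal to \<open>k\<close>. For the PND equation this holds because its left-hand side is, up to a factor,
  that form evaluated at \<open>\<eta> k e a - \<eta> k a e\<close> and \<open>\<eta> k f d - \<eta> k d f\<close>. For alignment it holds
  because the hyperplane is spanned by the members of a null frame other than \<open>n\<close>, once it is known
  that \<open>k\<close> is the first vector of some null frame. Such a frame is built by adding one unit vector
  at a time; in Lorentz signature the new vector can be normalised because a vector orthogonal to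
  \<open>k\<close> is never time-like.
\<close>

section \<open>Index pairing of a null frame\<close>

definition dual_index :: "nat \<Rightarrow> nat" where
  "dual_index i = (if i < 2 then 1 - i else i)"

lemma dual_index_dual_index [simp]: "dual_index (dual_index i) = i"
  by (auto simp: dual_index_def)

lemma dual_index_less: "2 \<le> p \<Longrightarrow> i < p \<Longrightarrow> dual_index i < p"
  by (auto simp: dual_index_def)

text \<open>Makes the Gram matrix of a null frame the permutation matrix of an involution. Pairing
  with \<open>m (dual_index i)\<close> therefore reads off the coefficient of
  \<open>m i\<close>.\<close>

lemma dual_index_gram:
  "((i, j) = (0, 1) \<or> (i, j) = (1, 0) \<or> (i = j \<and> 2 \<le> i)) \<longleftrightarrow> j = dual_index i"
  by (auto simp: dual_index_def)

text \<open>The field stays general so that the complex and the Lorentzian case share everything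
  except the normalisation of vectors. Nondegeneracy is left to the single lemmas, because in
  Lorentz signature it must first be derived.\<close>

locale symmetric_bilinear_space = vector_space s
  for s :: "'a::field_char_0 \<Rightarrow> 'v::ab_group_add \<Rightarrow> 'v" +
  fixes \<eta> :: "'v \<Rightarrow> 'v \<Rightarrow> 'a"
  assumes bilinear: "bilinear_form s \<eta>"
    and symmetric: "symmetric_form \<eta>"
begin

lemma form_commute: "\<eta> x y = \<eta> y x"
  using symmetric by (auto simp: symmetric_form_def)

lemma form_hom: "module_hom s (*) (\<lambda>x. \<eta> x y)"
  using bilinear by (auto simp: bilinear_form_def intro: Vector_Spaces.linear.axioms(3))

lemmas form_add_left = module_hom.add[OF form_hom]
  and form_diff_left = module_hom.diff[OF form_hom]
  and form_scale_left = module_hom.scale[OF form_hom]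
  and form_zero_left = module_hom.zero[OF form_hom]
  and form_sum_left = module_hom.sum[OF form_hom]

lemma form_hom_right: "module_hom s (*) (\<eta> x)"
  using bilinear by (auto simp: bilinear_form_def intro: Vector_Spaces.linear.axioms(3))

lemmas form_add_right = module_hom.add[OF form_hom_right]
  and form_diff_right = module_hom.diff[OF form_hom_right]
  and form_scale_right = module_hom.scale[OF form_hom_right]
  and form_zero_right = module_hom.zero[OF form_hom_right]
  and form_sum_right = module_hom.sum[OF form_hom_right]

lemmas form_simps = form_add_left form_diff_left form_scale_left form_zero_left
  form_add_right form_diff_right form_scale_right form_zero_right

lemma form_span_zero:
  assumes "x \<in> span B" "\<And>b. b \<in> B \<Longrightarrow> \<eta> b y = 0"
  shows "\<eta> x y = 0"
  using assms(1)
proof (rule span_induct)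
  show "subspace {x. \<eta> x y = 0}"
    by (auto simp: subspace_def form_simps)
qed (use assms(2) in auto)

section \<open>Partial null frames and projection onto their span\<close>

definition partial_null_frame :: "nat \<Rightarrow> (nat \<Rightarrow> 'v) \<Rightarrow> bool" where
  "partial_null_frame p m \<longleftrightarrow> (\<forall>i<p. \<forall>j<p. \<eta> (m i) (m j) = (if j = dual_index i then 1 else 0))"

lemma null_frame_iff: "null_frame s N \<eta> m \<longleftrightarrow> indexed_basis s N m \<and> partial_null_frame N m"
  unfolding null_frame_def partial_null_frame_def dual_index_gram ..

text \<open>Pairing with \<open>m (dual_index j)\<close> gives 1 on \<open>m j\<close> and 0 on all
  other members, so no member lies in the span of the others. The bound \<open>2 \<le> p\<close>
  keeps the dual index below \<open>p\<close>.\<close>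

lemma partial_null_frame_independent:
  assumes m: "partial_null_frame p m" and p: "2 \<le> p"
  shows "inj_on m {..<p}" "independent (m ` {..<p})"
proof -
  show inj: "inj_on m {..<p}"
  proof (rule inj_onI)
    fix i j assume ij: "i \<in> {..<p}" "j \<in> {..<p}" "m i = m j"
    then have "\<eta> (m j) (m (dual_index i)) = 1"
      using m dual_index_less[OF p, of i] unfolding partial_null_frame_def
      by (metis lessThan_iff)
    then show "i = j"
      using ij m dual_index_less[OF p, of i] unfolding partial_null_frame_def
      by (metis dual_index_dual_index lessThan_iff zero_neq_one)
  qed
  show "independent (m ` {..<p})"
  proof
    assume "dependent (m ` {..<p})"
    then obtain j where j: "j < p" "m j \<in> span (m ` {..<p} - {m j})"
      by (auto simp: dependent_def)
    have "\<eta> (m j) (m (dual_index j)) = 0"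
    proof (rule form_span_zero[OF j(2)])
      fix b assume "b \<in> m ` {..<p} - {m j}"
      then obtain i where "i < p" "b = m i" "i \<noteq> j" by auto
      then show "\<eta> b (m (dual_index j)) = 0"
        using m dual_index_less[OF p j(1)] unfolding partial_null_frame_def
        by (metis dual_index_dual_index)
    qed
    then show False
      using m j(1) dual_index_less[OF p j(1)] by (auto simp: partial_null_frame_def)
  qed
qed

text \<open>For a partial null frame with \<open>2 \<le> p\<close> this is the orthogonal projection
  onto the span.\<close>

definition frame_projection :: "nat \<Rightarrow> (nat \<Rightarrow> 'v) \<Rightarrow> 'v \<Rightarrow> 'v" where
  "frame_projection p m v = (\<Sum>i<p. s (\<eta> v (m (dual_index i))) (m i))"

lemma frame_projection_in_span: "frame_projection p m v \<in> span (m ` {..<p})"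
  unfolding frame_projection_def by (intro span_sum span_scale span_base) auto

lemma form_frame_projection:
  assumes m: "partial_null_frame p m" and p: "2 \<le> p" and j: "j < p"
  shows "\<eta> (frame_projection p m v) (m j) = \<eta> v (m j)"
proof -
  have "\<eta> (frame_projection p m v) (m j) =
      (\<Sum>i<p. \<eta> v (m (dual_index i)) * (if i = dual_index j then 1 else 0))"
    unfolding frame_projection_def form_sum_left form_scale_left
    using m j by (intro sum.cong refl) (auto simp: partial_null_frame_def)
  also have "\<dots> = \<eta> v (m j)"
    using dual_index_less[OF p j] by (simp add: sum.delta' if_distrib cong: if_cong)
  finally show ?thesis .
qed

lemma form_residual:
  assumes "partial_null_frame p m" "2 \<le> p" "j < p"
  shows "\<eta> (v - frame_projection p m v) (m j) = 0"
  using form_frame_projection[OF assms] by (simp add: form_simps)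

section \<open>Completing a null vector to a null frame\<close>

lemma exists_anisotropic:
  assumes nondeg: "nondegenerate_form \<eta>"
    and m: "partial_null_frame p m" and p: "2 \<le> p" and span: "span (m ` {..<p}) \<noteq> UNIV"
  shows "\<exists>u. (\<forall>j<p. \<eta> u (m j) = 0) \<and> \<eta> u u \<noteq> 0"
proof -
  obtain v where v: "v \<notin> span (m ` {..<p})" using span by auto
  define w where "w = v - frame_projection p m v"
  have w0: "\<forall>j<p. \<eta> w (m j) = 0"
    using form_residual[OF m p] by (simp add: w_def)
  have "w \<noteq> 0" using v frame_projection_in_span[of p m v] by (auto simp: w_def)
  \<comment> \<open>The residual \<open>w\<close> may itself be null, so a second vector is needed.
    Projecting \<open>y\<close> does not change its product with \<open>w\<close>, since
    \<open>w\<close> is orthogonal to the frame.\<close>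
  then obtain y where y: "\<eta> w y \<noteq> 0" using nondeg by (auto simp: nondegenerate_form_def)
  define z where "z = y - frame_projection p m y"
  have z0: "\<forall>j<p. \<eta> z (m j) = 0"
    using form_residual[OF m p] by (simp add: z_def)
  have "\<eta> (frame_projection p m y) w = 0"
    using w0 by (intro form_span_zero[OF frame_projection_in_span]) (auto simp: form_commute)
  then have wz: "\<eta> w z \<noteq> 0" using y by (simp add: z_def form_simps form_commute)
  \<comment> \<open>Polarisation: if \<open>w\<close>, \<open>z\<close> and \<open>w + z\<close>
    were all null, then \<open>2 * \<eta> w z\<close> would vanish.\<close>
  have "\<eta> (w + z) (w + z) = \<eta> w w + 2 * \<eta> w z + \<eta> z z"
    by (simp add: form_simps form_commute)
  then have "\<eta> w w \<noteq> 0 \<or> \<eta> z z \<noteq> 0 \<or> \<eta> (w + z) (w + z) \<noteq> 0"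
    using wz by auto
  moreover have "\<forall>j<p. \<eta> (w + z) (m j) = 0" using w0 z0 by (simp add: form_simps)
  ultimately show ?thesis using w0 z0 by blast
qed

lemma partial_null_frame_extend:
  assumes m: "partial_null_frame p m" and p: "2 \<le> p"
    and u: "\<forall>j<p. \<eta> u (m j) = 0" "\<eta> u u = 1"
  shows "partial_null_frame (Suc p) (m(p := u))"
proof -
  have "dual_index p = p" using p by (simp add: dual_index_def)
  moreover have "\<forall>i<p. dual_index i \<noteq> p" using dual_index_less[OF p] by force
  ultimately show ?thesis
    using m u by (auto simp: partial_null_frame_def less_Suc_eq form_commute)
qed

lemma partial_null_frame_pair:
  assumes "nondegenerate_form \<eta>" "k \<noteq> 0" "\<eta> k k = 0"
  shows "\<exists>m. partial_null_frame 2 m \<and> m 0 = k"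
proof -
  obtain y where y: "\<eta> k y \<noteq> 0" using assms by (auto simp: nondegenerate_form_def)
  define x where "x = s (inverse (\<eta> k y)) y"
  have kx: "\<eta> k x = 1" "\<eta> x k = 1"
    using y form_commute[of y k] by (simp_all add: x_def form_simps)
  \<comment> \<open>Since \<open>\<eta> k x = 1\<close>, subtracting \<open>a\<close> times
    \<open>k\<close> lowers \<open>\<eta> x x\<close> by \<open>2 * a\<close>; this choice of
    \<open>a\<close> makes \<open>n\<close> null.\<close>
  define n where "n = x - s (\<eta> x x / 2) k"
  have "\<eta> k n = 1" "\<eta> n k = 1" "\<eta> n n = 0"
    using assms(3) kx by (simp_all add: n_def form_simps)
  then have "partial_null_frame 2 (\<lambda>i. if i = 0 then k else n)"
    using assms(3) by (auto simp: partial_null_frame_def dual_index_def numeral_2_eq_2 less_Suc_eq)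
  then show ?thesis by force
qed

text \<open>Every vector added to the frame is orthogonal to \<open>m 0 = k\<close>. Hence
  \<open>normalise\<close> is required only on that hyperplane, which is what makes it available in
  Lorentz signature.\<close>

lemma null_frame_exists:
  assumes nondeg: "nondegenerate_form \<eta>" and dim: "dim UNIV = N" and N: "2 \<le> N"
    and k: "k \<noteq> 0" "\<eta> k k = 0"
    and normalise: "\<And>u. \<eta> u k = 0 \<Longrightarrow> \<eta> u u \<noteq> 0 \<Longrightarrow> \<exists>c. c * c * \<eta> u u = 1"
  shows "\<exists>m. null_frame s N \<eta> m \<and> m 0 = k"
proof -
  obtain B where B: "independent B" "UNIV \<subseteq> span B" "card B = N"
    using basis_exists[of UNIV] dim by auto
  have fin: "finite B" using B(3) N by (intro card_ge_0_finite) auto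
  have extend: "\<exists>m'. partial_null_frame (Suc p) m' \<and> m' 0 = k"
    if m: "partial_null_frame p m" "m 0 = k" and p: "2 \<le> p" and span: "span (m ` {..<p}) \<noteq> UNIV" for p m
  proof -
    obtain u where u: "\<forall>j<p. \<eta> u (m j) = 0" "\<eta> u u \<noteq> 0"
      using exists_anisotropic[OF nondeg m(1) p span] by blast
    obtain c where c: "c * c * \<eta> u u = 1"
      using normalise[of u] u p m(2) by force
    have "partial_null_frame (Suc p) (m(p := s c u))"
      using u c by (intro partial_null_frame_extend[OF m(1) p]) (auto simp: form_simps mult.assoc)
    then show ?thesis using p m(2) by (intro exI[of _ "m(p := s c u)"]) auto
  qed
  have bound: "p \<le> N" if "partial_null_frame p m" "2 \<le> p" for p m
    using independent_span_bound[OF fin partial_null_frame_independent(2)[OF that]] B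
      card_image[OF partial_null_frame_independent(1)[OF that]] by auto
  have "\<exists>m. partial_null_frame p m \<and> m 0 = k" if "2 \<le> p" "p \<le> N" for p
    using that
  proof (induction p rule: dec_induct)
    case base
    show ?case using partial_null_frame_pair[OF nondeg k] .
  next
    case (step p)
    then obtain m where m: "partial_null_frame p m" "m 0 = k" by auto
    \<comment> \<open>Fewer than \<open>N\<close> vectors cannot span a space that contains
      \<open>N\<close> independent ones.\<close>
    have "span (m ` {..<p}) \<noteq> UNIV"
      using independent_span_bound[OF _ B(1), of "m ` {..<p}"] B(3) step
        card_image_le[of "{..<p}" m] by auto
    then show ?case using extend[OF m] step by auto
  qed
  then obtain m where m: "partial_null_frame N m" "m 0 = k" using N by auto
  \<comment> \<open>Otherwise one more extension would give \<open>N + 1\<close> independent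
    vectors.\<close>
  have "span (m ` {..<N}) = UNIV"
    using extend[OF m N] bound[of "Suc N"] N by fastforce
  then show ?thesis
    using m partial_null_frame_independent[OF m(1) N]
    by (auto simp: null_frame_iff indexed_basis_def)
qed

text \<open>The coefficient of \<open>m 1\<close> in the expansion of \<open>x\<close> is
  \<open>\<eta> x (m 0)\<close>, which is 0, so \<open>x\<close> is a combination of members on
  which \<open>f\<close> vanishes.\<close>

lemma null_frame_hyperplane:
  assumes nondeg: "nondegenerate_form \<eta>" and m: "null_frame s N \<eta> m" and N: "2 \<le> N"
    and f: "module_hom s (*) f" "\<And>i. i < N \<Longrightarrow> i \<noteq> 1 \<Longrightarrow> f (m i) = 0"
    and x: "\<eta> x (m 0) = 0"
  shows "f x = 0"
proof -
  have frame: "partial_null_frame N m" "span (m ` {..<N}) = UNIV"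
    using m by (auto simp: null_frame_iff indexed_basis_def)
  have "f (s (\<eta> x (m (dual_index i))) (m i)) = 0" if "i < N" for i
    using f that x module_hom.scale[OF f(1)] module_hom.zero[OF f(1)] by (cases "i = 1") (auto simp: dual_index_def)
  then have "f (frame_projection N m x) = 0"
    by (simp add: frame_projection_def module_hom.sum[OF f(1)])
  \<comment> \<open>The residual is orthogonal to a spanning set, so nondegeneracy makes it
    zero.\<close>
  moreover have "x - frame_projection N m x = 0"
  proof -
    have "\<eta> y (x - frame_projection N m x) = 0" for y
      using form_residual[OF frame(1) N]
      by (intro form_span_zero[of y "m ` {..<N}"]) (auto simp: frame(2) form_commute)
    then show ?thesis
      using nondeg form_commute unfolding nondegenerate_form_def by metis
  qed
  ultimately show ?thesis by simp
qed

section \<open>Both conditions as vanishing on the hyperplane orthogonal to \<open>k\<close>\<close>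

lemma PND_equation_iff:
  assumes nondeg: "nondegenerate_form \<eta>" and C: "weyl_like s N \<eta> C"
    and k: "k \<noteq> 0" "\<eta> k k = 0"
  shows "PND_equation \<eta> C k \<longleftrightarrow> (\<forall>x y. \<eta> x k = 0 \<longrightarrow> \<eta> y k = 0 \<longrightarrow> C k x k y = 0)"
    (is "_ \<longleftrightarrow> ?R")
proof -
  have akkd: "C a k k d = - C k a k d" for a d
    using C unfolding weyl_like_def by blast
  have tensor: "rank4_tensor s C" using C by (simp add: weyl_like_def)
  have hom: "module_hom s (*) (\<lambda>x. C k x k y)" "module_hom s (*) (C k x k)" for x y
    using tensor by (auto simp: rank4_tensor_def intro: Vector_Spaces.linear.axioms(3))
  note hom_simps = module_hom.diff[OF hom(1)] module_hom.diff[OF hom(2)]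
    module_hom.scale[OF hom(1)] module_hom.scale[OF hom(2)]
  \<comment> \<open>Each antisymmetrization contributes a factor 1/2, and \<open>akkd\<close>
    contributes the sign.\<close>
  have component: "antisymmetrize (\<lambda>e a. antisymmetrize (\<lambda>d f. \<eta> k e * C a k k d * \<eta> k f) d f) e a
      = - C k (s (\<eta> k e) a - s (\<eta> k a) e) k (s (\<eta> k f) d - s (\<eta> k d) f) / 4" for e a d f
    unfolding antisymmetrize_def hom_simps akkd by (simp add: field_simps)
  show ?thesis
  proof
    assume pnd: "PND_equation \<eta> C k"
    \<comment> \<open>A vector off the hyperplane. With \<open>n\<close> in the slots
      \<open>e\<close> and \<open>f\<close>, the two arguments in \<open>component\<close> become
      non-zero multiples of \<open>x\<close> and \<open>y\<close>.\<close>
    obtain n where n: "\<eta> k n \<noteq> 0" using nondeg k(1) by (auto simp: nondegenerate_form_def)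
    show ?R
    proof (intro allI impI)
      fix x y assume xy: "\<eta> x k = 0" "\<eta> y k = 0"
      have "C k (s (\<eta> k n) x - s (\<eta> k x) n) k (s (\<eta> k n) y - s (\<eta> k y) n) = 0"
        using pnd unfolding PND_equation_def component by simp
      then show "C k x k y = 0"
        using n xy by (simp add: form_commute[of k x] form_commute[of k y] hom_simps)
    qed
  next
    assume R: ?R
    \<comment> \<open>Conversely, the arguments in \<open>component\<close> always lie in the
      hyperplane.\<close>
    have "\<eta> (s (\<eta> k e) a - s (\<eta> k a) e) k = 0" for a e
      by (simp add: form_simps form_commute)
    then show "PND_equation \<eta> C k"
      unfolding PND_equation_def component using R by simp
  qed
qed

lemma aligned_iff:
  assumes nondeg: "nondegenerate_form \<eta>" and C: "weyl_like s N \<eta> C" and N: "2 \<le> N"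
    and k: "k \<noteq> 0" "\<eta> k k = 0"
    and frame: "\<exists>m. null_frame s N \<eta> m \<and> m 0 = k"
  shows "aligned s N \<eta> C k \<longleftrightarrow> (\<forall>x y. \<eta> x k = 0 \<longrightarrow> \<eta> y k = 0 \<longrightarrow> C k x k y = 0)"
    (is "_ \<longleftrightarrow> ?R")
proof
  have anti: "C a b c d = - C b a c d" and pair: "C a b c d = C c d a b" for a b c d
    using C unfolding weyl_like_def by blast+
  have tensor: "rank4_tensor s C" using C by (simp add: weyl_like_def)
  have hom: "module_hom s (*) (\<lambda>w. C x w y z)" "module_hom s (*) (C x y z)"
    "module_hom s (*) (\<lambda>w. C w x y z)" "module_hom s (*) (\<lambda>w. C x y w z)" for x y z
    using tensor by (auto simp: rank4_tensor_def intro: Vector_Spaces.linear.axioms(3))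
  have zero: "C z z x y = 0" "C x y z z = 0" for x y z
    using anti[of z z x y] pair[of x y z z] by auto
  assume "aligned s N \<eta> C k"
  then obtain m c where m: "null_frame s N \<eta> m" "m 0 = s c k"
    and van: "\<forall>i\<in>{2..N - 1}. \<forall>j\<in>{2..N - 1}. C (m 0) (m i) (m 0) (m j) = 0"
    unfolding aligned_def by blast
  \<comment> \<open>Alignment covers the indices from 2 on; at index 0 the component vanishes
    because an antisymmetric pair of slots has equal entries.\<close>
  have comp: "C (m 0) (m i) (m 0) (m j) = 0" if "i < N" "i \<noteq> 1" "j < N" "j \<noteq> 1" for i j
    using van zero that by (cases "i = 0"; cases "j = 0") auto
  have "\<eta> (m 0) (m 1) = 1"
    using m(1) N unfolding null_frame_def by auto
  then have c: "c \<noteq> 0" using m(2) by (auto simp: form_simps)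
  show ?R
  proof (intro allI impI)
    fix x y assume "\<eta> x k = 0" "\<eta> y k = 0"
    then have xy: "\<eta> x (m 0) = 0" "\<eta> y (m 0) = 0" by (simp_all add: m(2) form_simps)
    \<comment> \<open>The hyperplane lemma is applied one slot at a time, first to \<open>y\<close>
      and then to \<open>x\<close>.\<close>
    have "C (m 0) (m i) (m 0) y = 0" if "i < N" "i \<noteq> 1" for i
      by (rule null_frame_hyperplane[OF nondeg m(1) N hom(2) _ xy(2)]) (use comp that in auto)
    then have "C (m 0) x (m 0) y = 0"
      by (intro null_frame_hyperplane[OF nondeg m(1) N hom(1) _ xy(1)])
    then show "C k x k y = 0"
      using c by (simp add: m(2) module_hom.scale[OF hom(3)] module_hom.scale[OF hom(4)])
  qed
next
  assume R: ?R
  obtain m where m: "null_frame s N \<eta> m" "m 0 = k" using frame by blast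
  have "\<eta> (m i) k = 0" if "i \<in> {2..N - 1}" for i
    using m N that unfolding null_frame_def by force
  then have "\<forall>i\<in>{2..N - 1}. \<forall>j\<in>{2..N - 1}. C (m 0) (m i) (m 0) (m j) = 0"
    using R m(2) by simp
  moreover have "m 0 = s 1 k" using m(2) by simp
  ultimately show "aligned s N \<eta> C k"
    using m(1) k unfolding aligned_def by blast
qed

theorem PND_equation_iff_aligned:
  assumes "nondegenerate_form \<eta>" "weyl_like s N \<eta> C" "2 \<le> N" "dim UNIV = N"
    and "k \<noteq> 0" "\<eta> k k = 0"
    and "\<And>u. \<eta> u k = 0 \<Longrightarrow> \<eta> u u \<noteq> 0 \<Longrightarrow> \<exists>c. c * c * \<eta> u u = 1"
  shows "PND_equation \<eta> C k \<longleftrightarrow> aligned s N \<eta> C k"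
  using PND_equation_iff[OF assms(1,2,5,6)] aligned_iff[OF assms(1-3,5,6)]
    null_frame_exists[OF assms(1,4,3,5-7)] by simp

end

section \<open>Lorentz signature\<close>

locale lorentz_space = symmetric_bilinear_space s \<eta>
  for s :: "real \<Rightarrow> 'v::ab_group_add \<Rightarrow> 'v" and \<eta> +
  fixes N :: nat and e :: "nat \<Rightarrow> 'v"
  assumes N: "0 < N" and basis: "indexed_basis s N e"
    and gram: "\<And>i j. i < N \<Longrightarrow> j < N \<Longrightarrow>
      \<eta> (e i) (e j) = (if i = j then (if i = 0 then - 1 else 1) else 0)"
begin

lemma expansion: "\<exists>x. v = (\<Sum>i<N. s (x i) (e i))"
proof -
  have "v \<in> span (e ` {..<N})" using basis by (simp add: indexed_basis_def)
  then obtain y where "v = (\<Sum>b\<in>e ` {..<N}. s (y b) b)"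
    by (auto simp: span_finite)
  then show ?thesis
    using basis by (intro exI[of _ "y \<circ> e"]) (simp add: sum.reindex indexed_basis_def)
qed

lemma form_expansion:
  assumes "j < N"
  shows "\<eta> (\<Sum>i<N. s (x i) (e i)) (e j) = (if j = 0 then - x j else x j)"
proof -
  have "\<eta> (\<Sum>i<N. s (x i) (e i)) (e j) = (\<Sum>i<N. if i = j then (if j = 0 then - x j else x j) else 0)"
    unfolding form_sum_left form_scale_left using assms gram by (intro sum.cong) auto
  then show ?thesis using assms by simp
qed

lemma nondegenerate: "nondegenerate_form \<eta>"
  unfolding nondegenerate_form_def
proof (intro allI impI)
  fix v assume v: "\<forall>y. \<eta> v y = 0"
  obtain x where x: "v = (\<Sum>i<N. s (x i) (e i))" using expansion by blast
  have "x j = 0" if "j < N" for j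
    using v form_expansion[OF that, of x] x by (auto split: if_splits)
  then show "v = 0" using x by simp
qed

text \<open>Orthogonality to the time-like \<open>e 0\<close> removes the only coefficient that
  enters with a negative sign, and a sum of squares remains.\<close>

lemma form_positive:
  assumes "\<eta> v (e 0) = 0"
  shows "0 \<le> \<eta> v v" "\<eta> v v = 0 \<Longrightarrow> v = 0"
proof -
  obtain x where x: "v = (\<Sum>i<N. s (x i) (e i))" using expansion by blast
  have x0: "x 0 = 0" using assms form_expansion[OF N, of x] x by simp
  have "\<eta> v v = (\<Sum>j<N. x j * \<eta> v (e j))"
    by (subst (2) x) (simp add: form_sum_right form_scale_right)
  also have "\<dots> = (\<Sum>j<N. (x j)\<^sup>2)"
    using form_expansion[of _ x] x x0 by (intro sum.cong) (auto simp: power2_eq_square)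
  finally have v: "\<eta> v v = (\<Sum>j<N. (x j)\<^sup>2)" .
  then show "0 \<le> \<eta> v v" by (simp add: sum_nonneg)
  show "v = 0" if "\<eta> v v = 0"
    using that unfolding v by (simp add: sum_nonneg_eq_0_iff x)
qed

text \<open>Adding a multiple of \<open>k\<close> to a multiple of \<open>u\<close> gives a vector
  orthogonal to \<open>e 0\<close>. Its square is a positive multiple of that of \<open>u\<close>,
  because all products with \<open>k\<close> vanish.\<close>

lemma orthogonal_null_nonneg:
  assumes k: "k \<noteq> 0" "\<eta> k k = 0" and u: "\<eta> u k = 0"
  shows "0 \<le> \<eta> u u"
proof -
  define a b where "a = \<eta> k (e 0)" and "b = \<eta> u (e 0)"
  \<comment> \<open>Otherwise \<open>k\<close> would be a non-zero null vector in the positive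
    definite complement of \<open>e 0\<close>.\<close>
  have a: "a \<noteq> 0" using form_positive(2)[of k] k by (auto simp: a_def)
  have "0 \<le> \<eta> (s a u - s b k) (s a u - s b k)"
    by (rule form_positive(1)) (simp add: form_simps a_def b_def)
  also have "\<dots> = a\<^sup>2 * \<eta> u u"
    using k u form_commute[of k u] by (simp add: form_simps power2_eq_square)
  finally show ?thesis using a by (simp add: zero_le_mult_iff)
qed

end

theorem proposition5p1:
  fixes N :: nat
    and sC :: "complex \<Rightarrow> 'v::ab_group_add \<Rightarrow> 'v"
    and \<eta>C :: "'v \<Rightarrow> 'v \<Rightarrow> complex"
    and CC :: "'v \<Rightarrow> 'v \<Rightarrow> 'v \<Rightarrow> 'v \<Rightarrow> complex"
    and kC :: 'v
    and sR :: "real \<Rightarrow> 'w::ab_group_add \<Rightarrow> 'w"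
    and \<eta>R :: "'w \<Rightarrow> 'w \<Rightarrow> real"
    and CR :: "'w \<Rightarrow> 'w \<Rightarrow> 'w \<Rightarrow> 'w \<Rightarrow> real"
    and kR :: 'w
  assumes "N \<ge> 2"
  shows
    "(vector_space sC \<and> vector_space.dim sC UNIV = N \<and>
      bilinear_form sC \<eta>C \<and> symmetric_form \<eta>C \<and> nondegenerate_form \<eta>C \<and>
      weyl_like sC N \<eta>C CC \<and> kC \<noteq> 0 \<and> \<eta>C kC kC = 0
      \<longrightarrow> (PND_equation \<eta>C CC kC \<longleftrightarrow> aligned sC N \<eta>C CC kC))
     \<and>
     (vector_space sR \<and> vector_space.dim sR UNIV = N \<and>
      bilinear_form sR \<eta>R \<and> symmetric_form \<eta>R \<and> lorentz_signature sR N \<eta>R \<and>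
      weyl_like sR N \<eta>R CR \<and> kR \<noteq> 0 \<and> \<eta>R kR kR = 0
      \<longrightarrow> (PND_equation \<eta>R CR kR \<longleftrightarrow> aligned sR N \<eta>R CR kR))"
proof (intro conjI impI; elim conjE)
  assume "vector_space sC" "bilinear_form sC \<eta>C" "symmetric_form \<eta>C"
  then interpret V: symmetric_bilinear_space sC \<eta>C
    by (simp add: symmetric_bilinear_space_def symmetric_bilinear_space_axioms_def)
  assume rest: "V.dim UNIV = N" "nondegenerate_form \<eta>C" "weyl_like sC N \<eta>C CC"
    "kC \<noteq> 0" "\<eta>C kC kC = 0"
  have "\<exists>c. c * c * \<eta>C u u = 1" if "\<eta>C u u \<noteq> 0" for u
    using that by (intro exI[of _ "csqrt (inverse (\<eta>C u u))"])
      (simp flip: power2_eq_square)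
  then show "PND_equation \<eta>C CC kC \<longleftrightarrow> aligned sC N \<eta>C CC kC"
    using V.PND_equation_iff_aligned rest assms by blast
next
  assume "vector_space sR" "bilinear_form sR \<eta>R" "symmetric_form \<eta>R"
    and "lorentz_signature sR N \<eta>R"
  then obtain e where "lorentz_space sR \<eta>R N e"
    using assms by (auto simp: lorentz_signature_def lorentz_space_def lorentz_space_axioms_def
        symmetric_bilinear_space_def symmetric_bilinear_space_axioms_def)
  then interpret W: lorentz_space sR \<eta>R N e .
  assume rest: "W.dim UNIV = N" "weyl_like sR N \<eta>R CR" "kR \<noteq> 0" "\<eta>R kR kR = 0"
  \<comment> \<open>The value \<open>\<eta>R u u\<close> is non-negative and non-zero, so its
    inverse has a real square root.\<close>
  have "\<exists>c. c * c * \<eta>R u u = 1" if "\<eta>R u kR = 0" "\<eta>R u u \<noteq> 0" for u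
    using that W.orthogonal_null_nonneg[OF rest(3,4), of u]
    by (intro exI[of _ "sqrt (inverse (\<eta>R u u))"]) simp
  then show "PND_equation \<eta>R CR kR \<longleftrightarrow> aligned sR N \<eta>R CR kR"
    using W.PND_equation_iff_aligned[OF W.nondegenerate] rest assms by blast
qed

end
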